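(* For every pca $\mathcal{A}$ there is an ordinal $\alpha$ such that $\sim_\alpha$ is equal to $\sim_{\alpha+1}$. Furthermore, the least such $\alpha$ is either $0$ or a limit ordinal.
   Context: A pca is a set $\mathcal{A}$ with partial application $ab$ (associating to the left) containing $K,S$ with $Kab$ defined and equal to $a$, and $Sab$ defined with $Sabc\simeq ac(bc)$. Closed terms are built from elements by application; $s\simeq t$ means both undefined or both defined and equal. Relations $\sim_\alpha$ on closed terms: $s\sim_0 t$ iff $s\simeq t$; $s \sim_{\alpha+1} t$ iff $sx \sim_\alpha tx$ for all $x\in\mathcal{A}$; for limit $\alpha$, $s\sim_\alpha t$ iff $s\sim_\beta t$ for some $\beta<\alpha$. *)

theory Defs
  imports Main "HOL-Library.Infinite_Typeclass"
begin

unbundle cardinal_syntax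

section \<open>Ordinals\<close>

text \<open>
  The type \<open>'b ordinal\<close> consists of the order types of all well-orders of subsets of \<open>'b\<close>.
  For infinite \<open>'b\<close> these are exactly the ordinals below the successor cardinal of the
  cardinality of \<open>'b\<close>.  They form an initial segment of the class of all ordinals, so zero,
  successors, limits, least elements and recursion mean the same as in that class.
\<close>

quotient_type 'b ordinal = "'b rel" / partial: "\<lambda>r s. r =o s"
proof (rule part_equivpI)
  show "\<exists>r :: 'b rel. r =o r"
    using ordIso_reflexive[of "{} :: 'b rel"] by auto
  show "symp (\<lambda>r s :: 'b rel. r =o s)"
    by (auto intro: sympI ordIso_symmetric)
  show "transp (\<lambda>r s :: 'b rel. r =o s)"
    by (auto intro: transpI ordIso_transitive)
qed

instantiation ordinal :: (type) wellorder
begin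

lift_definition less_eq_ordinal :: "'b ordinal \<Rightarrow> 'b ordinal \<Rightarrow> bool" is "\<lambda>r s. r \<le>o s"
  by (meson ordIso_ordLeq_trans ordIso_symmetric ordLeq_ordIso_trans)

lift_definition less_ordinal :: "'b ordinal \<Rightarrow> 'b ordinal \<Rightarrow> bool" is "\<lambda>r s. r <o s"
  by (meson ordIso_ordLess_trans ordIso_symmetric ordLess_ordIso_trans)

instance
proof
  fix x y z :: "'b ordinal"
  show "x < y \<longleftrightarrow> x \<le> y \<and> \<not> y \<le> x"
    by transfer (meson not_ordLess_ordLeq ordLeq_Well_order_simp ordLess_imp_ordLeq
        not_ordLeq_iff_ordLess)
  show "x \<le> x"
    by transfer (simp add: ordIso_imp_ordLeq)
  show "x \<le> y \<Longrightarrow> y \<le> z \<Longrightarrow> x \<le> z"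
    by transfer (rule ordLeq_transitive)
  show "x \<le> y \<Longrightarrow> y \<le> x \<Longrightarrow> x = y"
    by transfer (simp add: ordIso_iff_ordLeq)
  show "x \<le> y \<or> y \<le> x"
    by transfer (meson ordLeq_total ordIso_imp_ordLeq ordLeq_Well_order_simp)
next
  have wf: "wfp (\<lambda>x y :: 'b ordinal. x < y)"
  proof -
    have eq: "x < y \<longleftrightarrow> (rep_ordinal x, rep_ordinal y) \<in> ordLess" for x y :: "'b ordinal"
      by (simp add: less_ordinal.rep_eq)
    have "wf (inv_image ordLess (rep_ordinal :: 'b ordinal \<Rightarrow> 'b rel))"
      by (rule wf_inv_image[OF wf_ordLess])
    then show ?thesis
      by (simp only: wfp_def eq inv_image_def)
  qed
  fix P :: "'b ordinal \<Rightarrow> bool" and a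
  assume "\<And>x. (\<And>y. y < x \<Longrightarrow> P y) \<Longrightarrow> P x"
  then show "P a"
    using wfp_induct_rule[OF wf, of P a] by blast
qed

end

instantiation ordinal :: (type) zero
begin

lift_definition zero_ordinal :: "'b ordinal" is "{}"
  by (rule ordIso_reflexive) simp

instance ..

end

lemma zero_ordinal_le [simp]: "0 \<le> (\<alpha> :: 'b ordinal)"
proof transfer
  fix r :: "'b rel"
  assume "r =o r"
  then have "Well_order r"
    by (simp add: ordIso_def)
  then show "{} \<le>o r"
    by (simp add: ordLeq_def embed_def)
qed

lemma not_less_zero_ordinal [simp]: "\<not> (\<alpha> :: 'b ordinal) < 0"
  by (simp add: not_less)

definition ord_suc :: "'b ordinal \<Rightarrow> 'b ordinal" where
  "ord_suc \<alpha> = (LEAST \<beta>. \<alpha> < \<beta>)"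

definition limit_ordinal :: "'b ordinal \<Rightarrow> bool" where
  "limit_ordinal \<alpha> \<longleftrightarrow> \<alpha> \<noteq> 0 \<and> (\<nexists>\<beta>. \<alpha> = ord_suc \<beta>)"

lemma Well_order_add_top:
  fixes r :: "'a rel"
  assumes "Well_order r" and a: "a \<notin> Field r"
  defines "s \<equiv> r \<union> insert a (Field r) \<times> {a}"
  shows "Well_order s" and "r <o s"
proof -
  have F: "Field s = insert a (Field r)"
    unfolding s_def Field_def by auto
  have fld: "x \<in> Field r" "y \<in> Field r" if "(x, y) \<in> r" for x y
    using that by (auto simp: Field_def)
  have lin: "refl_on (Field r) r" "trans r" "antisym r" "total_on (Field r) r" "wf (r - Id)"
    using assms(1) by (auto simp: order_on_defs)
  have "refl_on (Field s) s"
    unfolding F using lin(1) by (auto simp: s_def refl_on_def)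
  moreover have "trans s"
    using lin(2) a fld unfolding trans_def s_def by blast
  moreover have "antisym s"
    using lin(3) a fld unfolding antisym_def s_def by blast
  moreover have "total_on (Field s) s"
    unfolding F using lin(4) by (auto simp: s_def total_on_def)
  moreover have "wf (s - Id)"
  proof -
    have eq: "s - Id = (r - Id) \<union> Field r \<times> {a}"
      using a by (auto simp: s_def)
    have "wf (Field r \<times> {a})"
    proof (rule wfI_min)
      fix x and Q :: "'a set"
      assume "x \<in> Q"
      then show "\<exists>z\<in>Q. \<forall>y. (y, z) \<in> Field r \<times> {a} \<longrightarrow> y \<notin> Q"
        using a by (cases "\<exists>z\<in>Q. z \<noteq> a") (blast, metis SigmaE2 singletonI)
    qed
    then show ?thesis
      unfolding eq using lin(5) a fld by (intro wf_Un) auto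
  qed
  moreover have "s \<subseteq> Field s \<times> Field s"
    by (auto simp: Field_def)
  ultimately show wo: "Well_order s"
    by (simp add: order_on_defs)
  have us: "underS s a = Field r"
    using a fld by (auto simp: underS_def s_def)
  have "Restr s (underS s a) = r"
    unfolding us using a fld by (auto simp: s_def)
  with underS_Restr_ordLess[OF wo, of a] F show "r <o s"
    by auto
qed

lemma ex_greater_ordinal: "\<exists>\<beta>. (\<alpha> :: 'b::infinite ordinal) < \<beta>"
proof transfer
  fix r :: "'b rel"
  assume "r =o r"
  then have wo: "Well_order r"
    by (simp add: ordIso_def)
  obtain b :: 'b and f :: "'b \<Rightarrow> 'b" where f: "bij_betw f UNIV (UNIV - {b})"
    using infinite_imp_bij_betw[OF infinite_UNIV] by blast
  then have inj: "inj_on f (Field r)" and b: "b \<notin> range f"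
    by (auto simp: bij_betw_def inj_on_def)
  let ?r = "dir_image r f"
  have iso: "r =o ?r" and wo': "Well_order ?r"
    using dir_image_ordIso[OF wo inj] Well_order_dir_image[OF wo inj] by auto
  have "b \<notin> Field ?r"
    using b by (auto simp: dir_image_Field)
  note top = Well_order_add_top[OF wo' this]
  show "\<exists>s \<in> {s :: 'b rel. s =o s}. r <o s"
    using ordIso_reflexive[OF top(1)] ordIso_ordLess_trans[OF iso top(2)] by blast
qed

lemma less_ord_suc: "(\<alpha> :: 'b::infinite ordinal) < ord_suc \<alpha>"
  unfolding ord_suc_def by (rule LeastI_ex[OF ex_greater_ordinal])

lemma ord_suc_least: "\<alpha> < \<beta> \<Longrightarrow> ord_suc \<alpha> \<le> \<beta>"
  unfolding ord_suc_def by (rule Least_le)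

lemma ord_suc_inject [simp]: "ord_suc \<alpha> = ord_suc \<beta> \<longleftrightarrow> \<alpha> = (\<beta> :: 'b::infinite ordinal)"
  by (metis less_ord_suc ord_suc_least leD neqE)

lemma ord_suc_not_zero [simp]: "ord_suc (\<alpha> :: 'b::infinite ordinal) \<noteq> 0"
  by (metis less_ord_suc not_less_zero_ordinal)


section \<open>Partial combinatory algebras\<close>

text \<open>Partial application is a function \<open>app\<close> into \<open>option\<close>, with \<open>None\<close> meaning undefined;
  the underlying set is the type \<open>'a\<close>.\<close>

datatype 'a cterm =
    Elem 'a
  | App "'a cterm" "'a cterm"  (infixl \<open>\<bullet>\<close> 75)

text \<open>Evaluation is strict: a term is defined only if all of its subterms are.\<close>

primrec den :: "('a \<Rightarrow> 'a \<Rightarrow> 'a option) \<Rightarrow> 'a cterm \<Rightarrow> 'a option" where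
  "den app (Elem a) = Some a"
| "den app (s \<bullet> t) =
     Option.bind (den app s) (\<lambda>a. Option.bind (den app t) (\<lambda>b. app a b))"

definition kleene_eq :: "('a \<Rightarrow> 'a \<Rightarrow> 'a option) \<Rightarrow> 'a cterm \<Rightarrow> 'a cterm \<Rightarrow> bool" where
  "kleene_eq app s t \<longleftrightarrow> den app s = den app t"

definition pca :: "('a \<Rightarrow> 'a \<Rightarrow> 'a option) \<Rightarrow> bool" where
  "pca app \<longleftrightarrow> (\<exists>K S.
     (\<forall>a b. den app (Elem K \<bullet> Elem a \<bullet> Elem b) = Some a) \<and>
     (\<forall>a b. den app (Elem S \<bullet> Elem a \<bullet> Elem b) \<noteq> None) \<and>
     (\<forall>a b c. kleene_eq app (Elem S \<bullet> Elem a \<bullet> Elem b \<bullet> Elem c)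
                             (Elem a \<bullet> Elem c \<bullet> (Elem b \<bullet> Elem c))))"

instance cterm :: (type) infinite
proof
  have "inj (\<lambda>n. ((\<lambda>t. t \<bullet> t) ^^ n) (Elem undefined :: 'a cterm))"
  proof (rule injI)
    fix m n
    show "((\<lambda>t. t \<bullet> t) ^^ m) (Elem undefined :: 'a cterm) = ((\<lambda>t. t \<bullet> t) ^^ n) (Elem undefined)
      \<Longrightarrow> m = n"
    proof (induction m arbitrary: n)
      case 0
      then show ?case by (cases n) auto
    next
      case (Suc m)
      then show ?case by (cases n) auto
    qed
  qed
  then show "infinite (UNIV :: 'a cterm set)"
    by (meson finite_subset infinite_iff_countable_subset subset_UNIV)
qed

text \<open>
  \<open>sim app \<alpha>\<close> is the relation \<open>\<sim>\<^sub>\<alpha>\<close>.  The three rules are its recursion clauses; since every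
  ordinal is of exactly one of the three kinds, they hold as equivalences (\<open>sim_zero_iff\<close>,
  \<open>sim_suc_iff\<close>, \<open>sim_limit_iff\<close>).

  The type of indices is a parameter.  The ordinals of type \<open>'a cterm ordinal\<close> suffice to index
  the whole hierarchy: the relations increase with \<open>\<alpha>\<close>, so a strictly increasing chain of them
  has at most as many steps as there are pairs of closed terms, that is, as there are closed terms.
\<close>

inductive sim ::
  "('a \<Rightarrow> 'a \<Rightarrow> 'a option) \<Rightarrow> 'b::infinite ordinal \<Rightarrow> 'a cterm \<Rightarrow> 'a cterm \<Rightarrow> bool"
  for app where
  sim_zero: "kleene_eq app s t \<Longrightarrow> sim app 0 s t"
| sim_suc: "(\<And>x. sim app \<alpha> (s \<bullet> Elem x) (t \<bullet> Elem x)) \<Longrightarrow> sim app (ord_suc \<alpha>) s t"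
| sim_limit: "limit_ordinal \<alpha> \<Longrightarrow> \<beta> < \<alpha> \<Longrightarrow> sim app \<beta> s t \<Longrightarrow> sim app \<alpha> s t"

lemma sim_zero_iff: "sim app 0 s t \<longleftrightarrow> kleene_eq app s t"
  by (auto intro: sim_zero elim: sim.cases simp: ord_suc_not_zero[symmetric] limit_ordinal_def
      simp del: ord_suc_not_zero dest: sym)

lemma sim_suc_iff: "sim app (ord_suc \<alpha>) s t \<longleftrightarrow> (\<forall>x. sim app \<alpha> (s \<bullet> Elem x) (t \<bullet> Elem x))"
  by (auto intro: sim_suc elim: sim.cases simp: limit_ordinal_def)

lemma sim_limit_iff:
  "limit_ordinal \<alpha> \<Longrightarrow> sim app \<alpha> s t \<longleftrightarrow> (\<exists>\<beta><\<alpha>. sim app \<beta> s t)"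
  by (auto intro: sim_limit elim: sim.cases simp: limit_ordinal_def)

end

theory Submission
  imports Defs
begin

text \<open>
  The relations \<open>\<sim>\<^sub>\<alpha>\<close> increase with \<open>\<alpha>\<close>. If the chain never stopped, a pair \<open>(s, t)\<close> new at each
  step, coded as the term \<open>s \<bullet> t\<close>, would inject the ordinals below the successor cardinal of the set
  of closed terms into that set. Suppose now that the chain stops at \<open>\<beta> + 1\<close>, and let
  \<open>s \<sim>\<^bsub>\<beta>+1\<^esub> t\<close>. The abstractions \<open>s' = \<lambda>x. s\<close> and \<open>t' = \<lambda>x. t\<close> satisfy \<open>s' \<sim>\<^bsub>\<beta>+2\<^esub> t'\<close>, hence
  \<open>s' \<sim>\<^bsub>\<beta>+1\<^esub> t'\<close>, that is \<open>s \<sim>\<^sub>\<beta> t\<close>; so the chain stops already at \<open>\<beta>\<close>.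
\<close>

lemma Well_order_le: "Well_order {(x, y :: 'a::wellorder). x \<le> y}"
proof -
  have "{(x, y :: 'a). x \<le> y} - Id = {(x, y). x < y}"
    by auto
  then have "wf ({(x, y :: 'a). x \<le> y} - Id)"
    using wf by simp
  moreover have "Field {(x, y :: 'a). x \<le> y} = UNIV"
    by (auto simp: Field_def)
  ultimately show ?thesis
    by (auto simp: order_on_defs refl_on_def trans_def antisym_def total_on_def)
qed

lemma strict_mono_imp_ge:
  fixes g :: "'a::wellorder \<Rightarrow> 'a"
  assumes "strict_mono g"
  shows "x \<le> g x"
proof (induction x rule: less_induct)
  case (less x)
  show ?case
  proof (rule ccontr)
    assume "\<not> x \<le> g x"
    then have "g x < x" by simp
    with less[OF this] strict_monoD[OF assms this] show False
      by simp
  qed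
qed

text \<open>Hartogs' argument: an injection would give a well-order of a subset of \<open>'b\<close> that is longer
  than every element of \<open>'b ordinal\<close>.\<close>

lemma not_inj_ordinal: "\<not> inj (f :: 'b ordinal \<Rightarrow> 'b)"
proof
  assume inj: "inj f"
  define r where "r = dir_image {(x, y :: 'b ordinal). x \<le> y} f"
  have wo: "Well_order r"
    unfolding r_def using inj by (intro Well_order_dir_image Well_order_le) (auto simp: inj_on_def)
  have r_iff: "(f x, f y) \<in> r \<longleftrightarrow> x \<le> y" for x y
    using inj by (auto simp: r_def dir_image_def inj_eq)
  have Field_r: "f x \<in> Field r" for x
    using r_iff[of x x] by (auto simp: Field_def)
  \<comment> \<open>Proper initial segments of \<open>r\<close> again live on \<open>'b\<close>, so
    their order types define a map \<open>g\<close> from \<open>'b ordinal\<close> to itself,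
    bounded by the type \<rho> of \<open>r\<close>.\<close>
  define seg where "seg x = Restr r (underS r (f x))" for x
  have wo_seg: "Well_order (seg x)" for x
    unfolding seg_def by (rule Well_order_Restr[OF wo])
  have Field_seg: "Field (seg x) = underS r (f x)" for x
    unfolding seg_def
    using wo by (intro Refl_Field_Restr2 underS_Field2) (auto simp: order_on_defs underS_Field)
  define \<rho> where "\<rho> = abs_ordinal r"
  define g where "g x = abs_ordinal (seg x)" for x
  have g_less: "g x < \<rho>" for x
    using underS_Restr_ordLess[OF wo] Field_r wo wo_seg
    by (auto simp: g_def \<rho>_def less_ordinal.abs_eq seg_def ordIso_reflexive)
  have "g x < g y" if "x < y" for x y
  proof -
    have mem: "f x \<in> underS r (f y)"
      using that inj by (auto simp: underS_def r_iff inj_eq)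
    have sub: "underS r (f x) \<subseteq> underS r (f y)"
      using wo that by (intro underS_incr) (auto simp: order_on_defs r_iff)
    have under: "underS (seg y) (f x) = underS r (f x)"
      using mem sub by (auto simp: seg_def underS_def)
    \<comment> \<open>\<open>seg x\<close> is a proper initial segment of \<open>seg y\<close> too,
      hence strictly shorter.\<close>
    have "Restr (seg y) (underS (seg y) (f x)) = seg x"
      unfolding under using sub by (auto simp: seg_def)
    with underS_Restr_ordLess[OF wo_seg, of y "f x"] mem have "seg x <o seg y"
      by (auto simp: Field_seg)
    then show ?thesis
      using wo_seg by (simp add: g_def less_ordinal.abs_eq ordIso_reflexive)
  qed
  \<comment> \<open>As \<rho> is itself an argument of \<open>g\<close>, the bound on
    \<open>g\<close> fails there.\<close>
  then have "\<rho> \<le> g \<rho>"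
    by (intro strict_mono_imp_ge strict_monoI)
  with g_less[of \<rho>] show False
    by simp
qed

text \<open>Needed because an abstraction applied to an element is only Kleene equal to the original
  term, not the same term.\<close>

lemma sim_cong:
  assumes "sim app \<alpha> s t" "kleene_eq app s s'" "kleene_eq app t t'"
  shows "sim app \<alpha> s' t'"
  using assms
proof (induction arbitrary: s' t' rule: sim.induct)
  case (sim_zero s t)
  then show ?case by (intro sim.sim_zero) (simp add: kleene_eq_def)
next
  case (sim_suc \<alpha> s t)
  show ?case
    by (rule sim.sim_suc, rule sim_suc.IH) (use sim_suc.prems in \<open>auto simp: kleene_eq_def\<close>)
next
  case (sim_limit \<alpha> \<beta> s t)
  then show ?case by (blast intro: sim.sim_limit)
qed

text \<open>Kleene equality survives application to an argument. At a limit \<alpha> with witness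
  \<beta> < \<alpha>, the induction hypothesis relates \<open>s \<bullet> Elem x\<close> and
  \<open>t \<bullet> Elem x\<close> at \<beta>, hence at \<alpha>.\<close>

lemma sim_imp_sim_suc:
  assumes "sim app \<alpha> s t"
  shows "sim app (ord_suc \<alpha>) s t"
  using assms
proof (induction rule: sim.induct)
  case (sim_zero s t)
  then show ?case by (auto simp: sim_suc_iff sim_zero_iff kleene_eq_def)
next
  case (sim_suc \<alpha> s t)
  then show ?case by (simp add: sim_suc_iff)
next
  case (sim_limit \<alpha> \<beta> s t)
  then show ?case by (auto simp: sim_suc_iff intro: sim.sim_limit)
qed

lemma sim_mono:
  assumes "\<alpha> \<le> \<beta>" "sim app \<alpha> s t"
  shows "sim app \<beta> s t"
  using assms(1)
proof (induction \<beta> rule: less_induct)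
  case (less \<beta>)
  show ?case
  proof (cases "\<alpha> = \<beta>")
    case True
    with assms(2) show ?thesis by simp
  next
    case False
    with less.prems have lt: "\<alpha> < \<beta>" by simp
    then consider \<gamma> where "\<beta> = ord_suc \<gamma>" | "limit_ordinal \<beta>"
      by (metis limit_ordinal_def not_less_zero_ordinal)
    then show ?thesis
    proof cases
      case 1
      then have "\<alpha> \<le> \<gamma>"
        using lt ord_suc_least[of \<gamma> \<alpha>] by (meson not_le)
      with 1 less.IH[of \<gamma>] less_ord_suc[of \<gamma>] show ?thesis
        by (simp add: sim_imp_sim_suc)
    next
      case 2
      with lt assms(2) show ?thesis by (blast intro: sim_limit)
    qed
  qed
qed

lemma ex_sim_eq_sim_suc:
  fixes app :: "'a \<Rightarrow> 'a \<Rightarrow> 'a option"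
  shows "\<exists>\<alpha> :: 'a cterm ordinal. sim app \<alpha> = sim app (ord_suc \<alpha>)"
proof (rule ccontr)
  assume "\<nexists>\<alpha> :: 'a cterm ordinal. sim app \<alpha> = sim app (ord_suc \<alpha>)"
  then have "\<forall>\<alpha> :: 'a cterm ordinal. \<exists>s t. sim app (ord_suc \<alpha>) s t \<and> \<not> sim app \<alpha> s t"
    unfolding fun_eq_iff using sim_imp_sim_suc by blast
  then obtain s t where new: "sim app (ord_suc \<alpha>) (s \<alpha>) (t \<alpha>)" "\<not> sim app \<alpha> (s \<alpha>) (t \<alpha>)"
    for \<alpha> :: "'a cterm ordinal"
    by metis
  \<comment> \<open>The pair chosen at \<alpha> is related from \<open>ord_suc \<alpha>\<close> on,
    hence at \<beta>, where the pair chosen at \<beta> is not.\<close>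
  have "s \<alpha> \<bullet> t \<alpha> \<noteq> s \<beta> \<bullet> t \<beta>" if "\<alpha> < \<beta>" for \<alpha> \<beta>
    using sim_mono[OF ord_suc_least[OF that] new(1)] new(2)[of \<beta>] by auto
  then have "inj (\<lambda>\<alpha>. s \<alpha> \<bullet> t \<alpha>)"
    by (intro linorder_injI)
  then show False
    using not_inj_ordinal by blast
qed

text \<open>Bracket abstraction: \<open>K a\<close> for an element, \<open>S a b\<close> for an
  application. As \<open>S a b\<close> is always defined, \<open>d\<close> exists even when
  \<open>s\<close> is undefined.\<close>

lemma pca_const_abstraction:
  assumes "pca app"
  obtains d where "\<And>x. kleene_eq app (Elem d \<bullet> Elem x) s"
proof -
  obtain K S where
    K: "\<And>a b. den app (Elem K \<bullet> Elem a \<bullet> Elem b) = Some a" and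
    S: "\<And>a b. den app (Elem S \<bullet> Elem a \<bullet> Elem b) \<noteq> None" and
    Sx: "\<And>a b c. den app (Elem S \<bullet> Elem a \<bullet> Elem b \<bullet> Elem c) =
      den app (Elem a \<bullet> Elem c \<bullet> (Elem b \<bullet> Elem c))"
    using assms unfolding pca_def kleene_eq_def by blast
  have "\<exists>d. \<forall>x. den app (Elem d \<bullet> Elem x) = den app s"
  proof (induction s)
    case (Elem a)
    \<comment> \<open>By strictness, \<open>K a\<close> is defined because \<open>K a x\<close> is;
      its value serves as \<open>d\<close>.\<close>
    have "\<forall>x. Option.bind (app K a) (\<lambda>d. app d x) = Some a"
      using K[of a] by simp
    then show ?case
      by (cases "app K a") auto
  next
    case (App u v)
    then obtain a b where
      ab: "\<And>x. den app (Elem a \<bullet> Elem x) = den app u" "\<And>x. den app (Elem b \<bullet> Elem x) = den app v"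
      by blast
    obtain d where d: "den app (Elem S \<bullet> Elem a \<bullet> Elem b) = Some d"
      using S[of a b] by blast
    have "den app (Elem d \<bullet> Elem x) = den app (u \<bullet> v)" for x
      using Sx[of a b x] d ab[of x] by (cases "app S a") auto
    then show ?case by blast
  qed
  then show thesis
    using that by (auto simp: kleene_eq_def)
qed

lemma sim_eq_sim_suc_pred:
  assumes "pca app" and eq: "sim app (ord_suc \<beta>) = sim app (ord_suc (ord_suc \<beta>))"
  shows "sim app \<beta> = sim app (ord_suc \<beta>)"
proof (intro ext iffI)
  fix s t
  show "sim app \<beta> s t \<Longrightarrow> sim app (ord_suc \<beta>) s t"
    by (rule sim_imp_sim_suc)
  assume suc: "sim app (ord_suc \<beta>) s t"
  obtain c where c: "\<And>x. kleene_eq app (Elem c \<bullet> Elem x) s"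
    using pca_const_abstraction[OF assms(1)] by blast
  obtain d where d: "\<And>x. kleene_eq app (Elem d \<bullet> Elem x) t"
    using pca_const_abstraction[OF assms(1)] by blast
  have "sim app (ord_suc \<beta>) (Elem c \<bullet> Elem x) (Elem d \<bullet> Elem x)" for x
    using sim_cong[OF suc] c d by (simp add: kleene_eq_def)
  then have "sim app (ord_suc (ord_suc \<beta>)) (Elem c) (Elem d)"
    by (rule sim_suc)
  then have "sim app (ord_suc \<beta>) (Elem c) (Elem d)"
    by (simp only: eq)
  \<comment> \<open>Any argument would do: \<open>c\<close> and \<open>d\<close> ignore it.\<close>
  then have "sim app \<beta> (Elem c \<bullet> Elem undefined) (Elem d \<bullet> Elem undefined)"
    by (simp add: sim_suc_iff)
  then show "sim app \<beta> s t"
    using c d by (rule sim_cong)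
qed

theorem theorem3p5:
  fixes app :: "'a \<Rightarrow> 'a \<Rightarrow> 'a option"
  assumes "pca app"
  shows "(\<exists>\<alpha> :: 'a cterm ordinal. sim app \<alpha> = sim app (ord_suc \<alpha>)) \<and>
         (let \<alpha> = (LEAST \<alpha> :: 'a cterm ordinal. sim app \<alpha> = sim app (ord_suc \<alpha>))
          in \<alpha> = 0 \<or> limit_ordinal \<alpha>)"
proof -
  define P where "P \<alpha> \<longleftrightarrow> sim app \<alpha> = sim app (ord_suc \<alpha>)" for \<alpha> :: "'a cterm ordinal"
  have ex: "\<exists>\<alpha>. P \<alpha>"
    unfolding P_def by (rule ex_sim_eq_sim_suc)
  \<comment> \<open>By \<open>limit_ordinal_def\<close>, excluding successors leaves only 0 and
    limits.\<close>
  have "(LEAST \<alpha>. P \<alpha>) \<noteq> ord_suc \<beta>" for \<beta>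
  proof
    assume least: "(LEAST \<alpha>. P \<alpha>) = ord_suc \<beta>"
    with LeastI_ex[OF ex] have "P (ord_suc \<beta>)"
      by simp
    then have "P \<beta>"
      unfolding P_def by (rule sim_eq_sim_suc_pred[OF assms])
    then have "ord_suc \<beta> \<le> \<beta>"
      unfolding least[symmetric] by (rule Least_le)
    with less_ord_suc[of \<beta>] show False
      by simp
  qed
  with ex show ?thesis
    by (auto simp: P_def Let_def limit_ordinal_def)
qed

end
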